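(* Let $b,c\in\mathbb{C}$ and consider the sequence of hypergeometric polynomials $$P(k)={}_2F_1\!\left(-k,\,b;\;1-k-c;\;z\right).$$ Suppose that for a positive integer $k$ we have $(b)_k\neq 0$, $(c)_k\neq 0$ and $(b+c)_k\neq 0$. Then: (1) the polynomials $P(k)$ and $P(k-1)$ (in the variable $z$) do not have common roots; (2) the polynomial $P(k)$ has $k$ distinct roots; (3) $z=1$ is not a root of $P(k)$.
   Context: $(\alpha)_j=\alpha(\alpha+1)\cdots(\alpha+j-1)$ denotes the Pochhammer symbol, with $(\alpha)_0=1$. For a non-negative integer $k$, the hypergeometric polynomial ${}_2F_1(-k,b;C;z)$ is the terminating sum $$\sum_{j=0}^{k}\frac{(-k)_j\,(b)_j}{(C)_j\,j!}\,z^j .$$ This finite-sum interpretation is also used when $C$ is an integer with $C\le -k$ (so that no denominator $(C)_j$, $0\le j\le k$, vanishes). In particular $P(0)=1$. Roots are taken in $\mathbb{C}$. *)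

theory Defs
  imports Complex_Main "HOL-Computational_Algebra.Polynomial"
begin

(* The terminating sum 2F1(-k, b; C; z) as a polynomial in z.  It has its intended meaning
   whenever pochhammer C j is nonzero for all j <= k; in particular C may be an integer
   with C <= -k.  If some pochhammer C j vanishes, the convention x / 0 = 0 applies. *)
definition hypergeom_poly :: "nat \<Rightarrow> complex \<Rightarrow> complex \<Rightarrow> complex poly" where
  "hypergeom_poly k b C =
     (\<Sum>j\<le>k. monom (pochhammer (- of_nat k) j * pochhammer b j / (pochhammer C j * fact j)) j)"

(* For C = 1 - k - c one has pochhammer C j = (-1)^j * (c + k - 1) * ... * (c + k - j), so
   pochhammer c k \<noteq> 0 guarantees that no denominator of hyp_seq b c k vanishes, nor any
   of hyp_seq b c (k - 1) when k > 0. *)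
definition hyp_seq :: "complex \<Rightarrow> complex \<Rightarrow> nat \<Rightarrow> complex poly" where
  "hyp_seq b c k = hypergeom_poly k b (1 - of_nat k - c)"

end

theory Submission
  imports Defs "HOL-Computational_Algebra.Fundamental_Theorem_Algebra"
begin

text \<open>
  Rescaled by \<open>(c)\<^sub>k / k!\<close>, the polynomial \<open>P(k)\<close> becomes \<open>Q\<^sub>k\<close>, the coefficient of \<open>t\<^sup>k\<close> in the
  generating function \<open>F = (1 - z t) powr (- b) * (1 - t) powr (- c)\<close>.  Each factor of \<open>F\<close>
  satisfies a first-order differential equation, and these become two relations between
  \<open>Q\<^sub>k\<close>, \<open>Q\<^sub>k\<^sub>-\<^sub>1\<close> and their derivatives (\<open>pderiv_rescaled_hyp_Suc\<close>, \<open>rescaled_hyp_euler_Suc\<close>).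
  Eliminating one derivative or the other leaves

  \<^item> \<open>(1 - z) Q\<^sub>k' = (b + c + k - 1) Q\<^sub>k\<^sub>-\<^sub>1 - k Q\<^sub>k\<close>,
  \<^item> \<open>k Q\<^sub>k = (b z + c + k - 1) Q\<^sub>k\<^sub>-\<^sub>1 - z (1 - z) Q\<^sub>k\<^sub>-\<^sub>1'\<close>.

  Everything follows from these two.  A common root \<open>z\<close> of \<open>Q\<^sub>k\<close> and \<open>Q\<^sub>k\<^sub>-\<^sub>1\<close> is nonzero because
  \<open>Q\<^sub>k(0) = (c)\<^sub>k / k!\<close>; the second relation then gives \<open>(1 - z) Q\<^sub>k\<^sub>-\<^sub>1'(z) = 0\<close>, and the first, one
  index lower, turns \<open>z\<close> into a root of \<open>Q\<^sub>k\<^sub>-\<^sub>2\<close>, since \<open>b + c + k - 2\<close> is a factor of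
  \<open>(b + c)\<^sub>k\<close>.  The descent ends at \<open>Q\<^sub>0 = 1\<close>, a contradiction (\<open>rescaled_hyp_no_common_root\<close>).
  A multiple root of \<open>Q\<^sub>k\<close> would by the first relation be a root of \<open>Q\<^sub>k\<^sub>-\<^sub>1\<close> too, so all roots are
  simple, and \<open>(b)\<^sub>k \<noteq> 0\<close> makes the degree equal to \<open>k\<close>.  At \<open>z = 1\<close> the first relation is a
  recursion whose solution is \<open>Q\<^sub>k(1) = (b + c)\<^sub>k / k!\<close>.
\<close>

text \<open>
  The convolution of the binomial series of \<open>(1 - z t) powr (- b)\<close> and \<open>(1 - t) powr (- c)\<close>.  With
  no parameter in a denominator, the relations between consecutive \<open>k\<close> hold for all \<open>b\<close> and \<open>c\<close>.
\<close>
definition rescaled_hyp :: "complex \<Rightarrow> complex \<Rightarrow> nat \<Rightarrow> complex poly" where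
  "rescaled_hyp b c k = (\<Sum>j\<le>k. monom
     (pochhammer b j / fact j * (pochhammer c (k - j) / fact (k - j))) j)"

lemma coeff_rescaled_hyp:
  "coeff (rescaled_hyp b c k) j =
     (if j \<le> k then pochhammer b j / fact j * (pochhammer c (k - j) / fact (k - j)) else 0)"
  by (simp add: rescaled_hyp_def coeff_sum)

lemma rescaled_hyp_0 [simp]: "rescaled_hyp b c 0 = 1"
  by (simp add: rescaled_hyp_def)

lemma poly_rescaled_hyp_at_0: "poly (rescaled_hyp b c k) 0 = pochhammer c k / fact k"
  by (simp add: poly_0_coeff_0 coeff_rescaled_hyp)

lemma degree_rescaled_hyp:
  assumes "pochhammer b k \<noteq> 0"
  shows "degree (rescaled_hyp b c k) = k"
proof (rule antisym)
  show "degree (rescaled_hyp b c k) \<le> k"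
    by (rule degree_le) (simp add: coeff_rescaled_hyp)
  show "k \<le> degree (rescaled_hyp b c k)"
    by (rule le_degree) (simp add: coeff_rescaled_hyp assms)
qed

lemma pochhammer_reverse:
  fixes c :: "'a :: comm_ring_1"
  assumes "j \<le> k"
  shows "pochhammer c (k - j) * pochhammer (1 - of_nat k - c) j = (- 1) ^ j * pochhammer c k"
proof -
  have "pochhammer (1 - of_nat k - c) j = (- 1) ^ j * pochhammer (c + of_nat (k - j)) j"
    using pochhammer_minus[of "of_nat k + c - 1" j] assms by (simp add: of_nat_diff algebra_simps)
  then show ?thesis
    using pochhammer_product'[of c "k - j" j] assms by simp
qed

text \<open>
  Reversing \<open>(- k)\<^sub>j\<close> (the case \<open>c = 1\<close>) and \<open>(1 - k - c)\<^sub>j\<close> produces the same sign, so it cancels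
  from each coefficient of \<open>P(k)\<close>.
\<close>
lemma smult_hyp_seq:
  assumes "pochhammer c k \<noteq> 0"
  shows "smult (pochhammer c k / fact k) (hyp_seq b c k) = rescaled_hyp b c k"
proof (rule poly_eqI)
  fix j
  show "coeff (smult (pochhammer c k / fact k) (hyp_seq b c k)) j = coeff (rescaled_hyp b c k) j"
  proof (cases "j \<le> k")
    case True
    have num: "fact (k - j) * pochhammer (- of_nat k) j = (- 1) ^ j * (fact k :: complex)"
      using pochhammer_reverse[OF True, of "1 :: complex"] by (simp add: pochhammer_fact)
    have den: "pochhammer c (k - j) * pochhammer (1 - of_nat k - c) j = (- 1) ^ j * pochhammer c k"
      using True by (rule pochhammer_reverse)
    with assms have "pochhammer (1 - of_nat k - c) j \<noteq> 0"
      by auto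
    moreover have "pochhammer c k * pochhammer (- of_nat k) j * fact (k - j) =
        pochhammer c (k - j) * pochhammer (1 - of_nat k - c) j * fact k"
      unfolding den using num by (simp add: ac_simps)
    ultimately show ?thesis
      using True
      by (simp add: hyp_seq_def hypergeom_poly_def coeff_sum coeff_rescaled_hyp divide_simps)
         (simp add: ac_simps)
  next
    case False
    then show ?thesis
      by (simp add: hyp_seq_def hypergeom_poly_def coeff_sum coeff_rescaled_hyp)
  qed
qed

lemma poly_hyp_seq_eq_0_iff:
  assumes "pochhammer c k \<noteq> 0"
  shows "poly (hyp_seq b c k) z = 0 \<longleftrightarrow> poly (rescaled_hyp b c k) z = 0"
  using assms by (simp flip: smult_hyp_seq)

lemma Suc_times_pochhammer_over_fact:
  fixes a :: "'a :: field_char_0"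
  shows "of_nat (Suc n) * (pochhammer a (Suc n) / fact (Suc n)) =
     (a + of_nat n) * (pochhammer a n / fact n)"
  by (simp add: pochhammer_Suc divide_simps del: of_nat_Suc)

lemma coeff_pCons_pderiv: "coeff (pCons 0 (pderiv p)) j = of_nat j * coeff p j"
  by (cases j) (simp_all add: coeff_pderiv)

text \<open>
  The factor \<open>(1 - z t) powr (- b)\<close> of the generating function: this is the coefficient form of
  \<open>(1 - z t) \<partial>F/\<partial>z = b t F\<close>.
\<close>
lemma pderiv_rescaled_hyp_Suc:
  "pderiv (rescaled_hyp b c (Suc k)) =
     pCons 0 (pderiv (rescaled_hyp b c k)) + smult b (rescaled_hyp b c k)"
proof (rule poly_eqI)
  fix j
  show "coeff (pderiv (rescaled_hyp b c (Suc k))) j =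
      coeff (pCons 0 (pderiv (rescaled_hyp b c k)) + smult b (rescaled_hyp b c k)) j"
    using arg_cong[OF Suc_times_pochhammer_over_fact[of j b],
        of "\<lambda>x. x * (pochhammer c (k - j) / fact (k - j))"]
    by (simp add: coeff_pderiv coeff_pCons_pderiv coeff_rescaled_hyp algebra_simps add_divide_distrib
        del: of_nat_Suc fact_Suc)
qed

text \<open>
  The factor \<open>(1 - t) powr (- c)\<close>: this is the coefficient form of
  \<open>(1 - t) (t \<partial>F/\<partial>t - z \<partial>F/\<partial>z) = c t F\<close>, where the operator \<open>t \<partial>/\<partial>t - z \<partial>/\<partial>z\<close> kills every function
  of \<open>z t\<close>, hence the other factor.
\<close>
lemma rescaled_hyp_euler_Suc:
  "smult (of_nat (Suc k)) (rescaled_hyp b c (Suc k)) - pCons 0 (pderiv (rescaled_hyp b c (Suc k))) =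
     smult (c + of_nat k) (rescaled_hyp b c k) - pCons 0 (pderiv (rescaled_hyp b c k))"
  (is "?lhs = ?rhs")
proof (rule poly_eqI)
  fix j
  consider i where "k = j + i" | "j = Suc k" | "j > Suc k"
    by (metis less_iff_Suc_add nat_le_iff_add not_less_eq not_le less_antisym)
  then show "coeff ?lhs j = coeff ?rhs j"
  proof cases
    case (1 i)
    have "coeff ?lhs j = pochhammer b j / fact j *
        (of_nat (Suc i) * (pochhammer c (Suc i) / fact (Suc i)))"
      by (simp add: 1 coeff_pCons_pderiv coeff_rescaled_hyp Suc_diff_le algebra_simps add_divide_distrib
          del: fact_Suc)
    also have "\<dots> = coeff ?rhs j"
      unfolding Suc_times_pochhammer_over_fact
      by (simp add: 1 coeff_pCons_pderiv coeff_rescaled_hyp algebra_simps add_divide_distrib)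
    finally show ?thesis .
  qed (simp_all add: coeff_pCons_pderiv coeff_rescaled_hyp del: coeff_pCons_Suc fact_Suc)
qed

text \<open>
  The two relations above are linear in \<open>Q\<^sub>k\<^sub>+\<^sub>1'\<close> and \<open>Q\<^sub>k'\<close>.  Eliminating \<open>Q\<^sub>k'\<close> expresses a
  derivative by values at two consecutive indices; eliminating \<open>Q\<^sub>k\<^sub>+\<^sub>1'\<close>, as in the next lemma,
  expresses the next value by the value and derivative at \<open>k\<close>.
\<close>
lemma one_minus_times_pderiv_rescaled_hyp_Suc:
  "(1 - z) * poly (pderiv (rescaled_hyp b c (Suc k))) z =
     (b + c + of_nat k) * poly (rescaled_hyp b c k) z
     - of_nat (Suc k) * poly (rescaled_hyp b c (Suc k)) z"
  using arg_cong[OF pderiv_rescaled_hyp_Suc[of b c k], of "\<lambda>p. poly p z"]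
    arg_cong[OF rescaled_hyp_euler_Suc[of k b c], of "\<lambda>p. poly p z"]
  by (simp add: algebra_simps)

lemma rescaled_hyp_Suc_eq:
  "of_nat (Suc k) * poly (rescaled_hyp b c (Suc k)) z =
     (b * z + c + of_nat k) * poly (rescaled_hyp b c k) z
     - z * (1 - z) * poly (pderiv (rescaled_hyp b c k)) z"
  using arg_cong[OF pderiv_rescaled_hyp_Suc[of b c k], of "\<lambda>p. poly p z"]
    arg_cong[OF rescaled_hyp_euler_Suc[of k b c], of "\<lambda>p. poly p z"]
  by (simp add: algebra_simps)

text \<open>
  At \<open>z = 1\<close> the derivative drops out of the first eliminated relation, so the values there
  satisfy the recursion of \<open>(b + c)\<^sub>k / k!\<close>.
\<close>
lemma poly_rescaled_hyp_at_1: "poly (rescaled_hyp b c k) 1 = pochhammer (b + c) k / fact k"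
proof (induction k)
  case (Suc k)
  have "of_nat (Suc k) * poly (rescaled_hyp b c (Suc k)) 1 =
      (b + c + of_nat k) * (pochhammer (b + c) k / fact k)"
    using one_minus_times_pderiv_rescaled_hyp_Suc[of 1 b c k] Suc by simp
  then show ?case
    by (simp add: pochhammer_Suc field_simps del: of_nat_Suc)
qed simp

lemma pochhammer_Suc_neq_0D:
  fixes a :: "'a :: idom"
  assumes "pochhammer a (Suc k) \<noteq> 0"
  shows "pochhammer a k \<noteq> 0" "a + of_nat k \<noteq> 0"
  using assms by (simp_all add: pochhammer_Suc)

text \<open>
  A common root at indices \<open>k + 2\<close> and \<open>k + 1\<close> is also a root at index \<open>k\<close>; the induction
  hypothesis forbids the pair \<open>k + 1\<close>, \<open>k\<close>.
\<close>
lemma rescaled_hyp_no_common_root: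
  assumes "pochhammer c (Suc k) \<noteq> 0" "pochhammer (b + c) k \<noteq> 0"
    and "poly (rescaled_hyp b c (Suc k)) z = 0"
  shows "poly (rescaled_hyp b c k) z \<noteq> 0"
  using assms
proof (induction k)
  case (Suc k)
  show ?case
  proof
    assume root: "poly (rescaled_hyp b c (Suc k)) z = 0"
    have "z \<noteq> 0"
      using root pochhammer_Suc_neq_0D(1)[OF Suc.prems(1)]
      by (auto simp: poly_rescaled_hyp_at_0 simp del: fact_Suc)
    then have "(1 - z) * poly (pderiv (rescaled_hyp b c (Suc k))) z = 0"
      using rescaled_hyp_Suc_eq[of "Suc k" b c z] root Suc.prems(3) by (simp del: of_nat_Suc)
    then have "(b + c + of_nat k) * poly (rescaled_hyp b c k) z = 0"
      using one_minus_times_pderiv_rescaled_hyp_Suc[of z b c k] root by simp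
    then have "poly (rescaled_hyp b c k) z = 0"
      using pochhammer_Suc_neq_0D(2)[OF Suc.prems(2)] by simp
    moreover have "poly (rescaled_hyp b c k) z \<noteq> 0"
      using Suc.IH Suc.prems root by (simp add: pochhammer_Suc_neq_0D(1))
    ultimately show False
      by contradiction
  qed
qed simp

lemma rsquarefree_rescaled_hyp:
  assumes "pochhammer c (Suc k) \<noteq> 0" "pochhammer (b + c) (Suc k) \<noteq> 0"
  shows "rsquarefree (rescaled_hyp b c (Suc k))"
  unfolding rsquarefree_roots
proof (intro allI notI, elim conjE)
  fix z
  assume root: "poly (rescaled_hyp b c (Suc k)) z = 0"
    and "poly (pderiv (rescaled_hyp b c (Suc k))) z = 0"
  then have "(b + c + of_nat k) * poly (rescaled_hyp b c k) z = 0"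
    using one_minus_times_pderiv_rescaled_hyp_Suc[of z b c k] by simp
  then show False
    using rescaled_hyp_no_common_root[OF assms(1) _ root] pochhammer_Suc_neq_0D[OF assms(2)]
    by simp
qed

lemma card_roots_rsquarefree:
  fixes p :: "complex poly"
  assumes "rsquarefree p"
  shows "card {z. poly p z = 0} = degree p"
proof -
  have "p \<noteq> 0"
    using assms by (simp add: rsquarefree_def)
  then have "degree p = degree (\<Prod>z | poly p z = 0. [:- z, 1:])"
    using arg_cong[OF complex_poly_decompose_rsquarefree[OF assms], of degree] by simp
  also have "\<dots> = card {z. poly p z = 0}"
    by (subst degree_prod_eq_sum_degree) auto
  finally show ?thesis ..
qed

theorem lemma2p1:
  fixes b c :: complex and k :: nat
  assumes "k > 0"
    and "pochhammer b k \<noteq> 0"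
    and "pochhammer c k \<noteq> 0"
    and "pochhammer (b + c) k \<noteq> 0"
  shows "(\<nexists>z. poly (hyp_seq b c k) z = 0 \<and> poly (hyp_seq b c (k - 1)) z = 0)
    \<and> card {z. poly (hyp_seq b c k) z = 0} = k
    \<and> poly (hyp_seq b c k) 1 \<noteq> 0"
proof -
  obtain n where k: "k = Suc n"
    using \<open>k > 0\<close> gr0_implies_Suc by blast
  have c: "pochhammer c (Suc n) \<noteq> 0" "pochhammer c n \<noteq> 0"
    and bc: "pochhammer (b + c) (Suc n) \<noteq> 0" "pochhammer (b + c) n \<noteq> 0"
    using assms(3,4) by (simp_all add: k pochhammer_Suc_neq_0D(1))
  have "card {z. poly (rescaled_hyp b c k) z = 0} = k"
    using card_roots_rsquarefree[OF rsquarefree_rescaled_hyp[OF c(1) bc(1)]]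
      degree_rescaled_hyp[OF assms(2)] by (simp add: k)
  moreover have "\<nexists>z. poly (rescaled_hyp b c (Suc n)) z = 0 \<and> poly (rescaled_hyp b c n) z = 0"
    using rescaled_hyp_no_common_root[OF c(1) bc(2)] by blast
  moreover have "poly (rescaled_hyp b c k) 1 \<noteq> 0"
    using assms(4) by (simp add: poly_rescaled_hyp_at_1)
  ultimately show ?thesis
    by (simp add: k poly_hyp_seq_eq_0_iff c)
qed

end
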